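(* Let $\mathcal{A}$ be a unital $C^*$-algebra and let $a\in\mathcal{A}$ be invertible. Then there exists a unique unitary $u\in\mathcal{A}$ such that, for every central projection $p\in\mathcal{A}$, $a$ is a positive element of the $C^*$-algebra $\mathcal{A}(u^*,p)$.
   Context: For a unitary $v\in\mathcal{A}$ and a central projection $p\in\mathcal{A}$ (a self-adjoint idempotent in the center of $\mathcal{A}$), $\mathcal{A}(v,p)$ denotes the normed space $\mathcal{A}$ (with its original vector space structure and norm) equipped with the multiplication $x\circ y = p\,x\,v\,y+(1-p)\,y\,v\,x$ and the involution $x^\star = v^*x^*v^*$, where products and ${}^*$ on the right-hand sides are those of $\mathcal{A}$; this is a unital $C^*$-algebra with unit $v^*$. In particular, $\mathcal{A}(u^*,p)$ has multiplication $x\circ y=p\,x\,u^*y+(1-p)\,y\,u^*x$, involution $x^\star=u\,x^*u$ and unit $u$. An element is positive in a $C^*$-algebra if it is of the form $b^\star\circ b$ (with respect to the involution and multiplication of that $C^*$-algebra). *)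

theory Defs
  imports "HOL-Analysis.Analysis"
begin

text \<open>
  Complex unital C*-algebras. The real Banach algebra structure, including \<open>norm 1 = 1\<close> and
  hence \<open>0 \<noteq> 1\<close>, comes from the library classes; complex scalars extend the real ones.
\<close>

class unital_cstar_algebra = real_normed_algebra_1 + banach +
  fixes scaleC :: "complex \<Rightarrow> 'a \<Rightarrow> 'a"  (infixr \<open>*\<^sub>C\<close> 75)
    and star :: "'a \<Rightarrow> 'a"
  assumes scaleC_add_right: "c *\<^sub>C (x + y) = c *\<^sub>C x + c *\<^sub>C y"
    and scaleC_add_left: "(c + d) *\<^sub>C x = c *\<^sub>C x + d *\<^sub>C x"
    and scaleC_scaleC: "c *\<^sub>C (d *\<^sub>C x) = (c * d) *\<^sub>C x"
    and scaleR_scaleC: "r *\<^sub>R x = complex_of_real r *\<^sub>C x"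
    and norm_scaleC: "norm (c *\<^sub>C x) = cmod c * norm x"
    and mult_scaleC_left: "(c *\<^sub>C x) * y = c *\<^sub>C (x * y)"
    and mult_scaleC_right: "x * (c *\<^sub>C y) = c *\<^sub>C (x * y)"
    and star_star: "star (star x) = x"
    and star_add: "star (x + y) = star x + star y"
    and star_scaleC: "star (c *\<^sub>C x) = cnj c *\<^sub>C star x"
    and star_mult: "star (x * y) = star y * star x"
    and cstar_identity: "norm (star x * x) = (norm x)\<^sup>2"

instantiation complex :: unital_cstar_algebra
begin

definition scaleC_complex :: "complex \<Rightarrow> complex \<Rightarrow> complex" where
  "scaleC_complex c x = c * x"

definition star_complex :: "complex \<Rightarrow> complex" where
  "star_complex x = cnj x"

instance
  by standard
    (simp_all add: scaleC_complex_def star_complex_def algebra_simps norm_mult scaleR_conv_of_real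
      power2_eq_square)

end

definition invertible_element :: "'a::unital_cstar_algebra \<Rightarrow> bool" where
  "invertible_element a \<longleftrightarrow> (\<exists>b. a * b = 1 \<and> b * a = 1)"

definition unitary :: "'a::unital_cstar_algebra \<Rightarrow> bool" where
  "unitary u \<longleftrightarrow> star u * u = 1 \<and> u * star u = 1"

definition central_projection :: "'a::unital_cstar_algebra \<Rightarrow> bool" where
  "central_projection p \<longleftrightarrow> star p = p \<and> p * p = p \<and> (\<forall>x. p * x = x * p)"

text \<open>
  A second C*-algebra structure on the same normed space: only multiplication, unit and
  involution vary, while the vector space structure and the norm stay those of the type.
\<close>

record 'a cstar_ops =
  cmult :: "'a \<Rightarrow> 'a \<Rightarrow> 'a"
  cunit :: 'a
  cinvol :: "'a \<Rightarrow> 'a"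

definition positive_in :: "'a cstar_ops \<Rightarrow> 'a \<Rightarrow> bool" where
  "positive_in A a \<longleftrightarrow> (\<exists>b. a = cmult A (cinvol A b) b)"

definition isotope :: "'a::unital_cstar_algebra \<Rightarrow> 'a \<Rightarrow> 'a cstar_ops" where
  "isotope v p =
     \<lparr> cmult = (\<lambda>x y. p * x * v * y + (1 - p) * y * v * x),
       cunit = star v,
       cinvol = (\<lambda>x. star v * star x * star v) \<rparr>"

end

theory Submission
  imports Defs
begin

text \<open>
  The unitary is the one of the polar decomposition \<open>a = u h\<close> with \<open>h = (a\<^sup>* a)\<^bsup>1/2\<^esup>\<close>. Whatever
  \<open>p\<close> is, \<open>b = u h\<^bsup>1/2\<^esup>\<close> is selfadjoint in the isotope and its square there is \<open>a\<close>. Conversely,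
  positivity for \<open>p = 1\<close> alone says that \<open>u\<^sup>* a\<close> has the form \<open>b\<^sup>* b\<close>, hence is the positive square
  root of \<open>a\<^sup>* a\<close>. That an invertible \<open>k = b\<^sup>* b\<close> is positive is shown without spectral theory:
  with \<open>h = (k\<^sup>2)\<^bsup>1/2\<^esup>\<close> and \<open>w = b h\<^bsup>-1/2\<^esup>\<close>, the element \<open>j = w\<^sup>* w = k h\<^bsup>-1\<^esup>\<close> satisfies \<open>j\<^sup>2 = 1\<close>,
  and \<open>v\<^sup>* v\<close> is the negative of the projection \<open>(1 - j) / 2\<close> for \<open>v = w (1 - j) / 2\<close>, which forces
  that projection to vanish.
\<close>

section \<open>The involution\<close>

lemma star_diff: "star (x - y) = star x - star (y::'a::unital_cstar_algebra)"
  by (metis add_diff_cancel diff_add_cancel star_add)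

lemma star_zero [simp]: "star 0 = (0::'a::unital_cstar_algebra)"
  using star_diff[of "0::'a" 0] by simp

lemma star_minus: "star (- x) = - star (x::'a::unital_cstar_algebra)"
  using star_diff[of 0 x] by simp

lemma star_scaleR: "star (r *\<^sub>R x) = r *\<^sub>R star (x::'a::unital_cstar_algebra)"
  by (simp add: scaleR_scaleC star_scaleC)

lemma star_one [simp]: "star 1 = (1::'a::unital_cstar_algebra)"
  by (metis mult_1 star_mult star_star)

lemma norm_le_norm_star: "norm x \<le> norm (star (x::'a::unital_cstar_algebra))"
proof (cases "x = 0")
  case False
  have "norm x * norm x \<le> norm (star x) * norm x"
    by (metis cstar_identity norm_mult_ineq power2_eq_square)
  with False show ?thesis by simp
qed simp

lemma norm_star [simp]: "norm (star x) = norm (x::'a::unital_cstar_algebra)"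
  by (metis norm_le_norm_star order_antisym star_star)

lemma continuous_on_star [continuous_intros]:
  "continuous_on S (star :: 'a::unital_cstar_algebra \<Rightarrow> 'a)"
  by (rule bounded_linear.continuous_on[OF bounded_linear_intro[where K = 1]])
    (simp_all add: star_add star_scaleR continuous_on_id)

lemma star_inverse_selfadjoint:
  fixes k m :: "'a::unital_cstar_algebra"
  assumes "star k = k" "k * m = 1" "m * k = 1"
  shows "star m = m"
proof -
  have "star m * k = 1"
    using assms by (metis star_mult star_one)
  then show ?thesis
    using assms by (metis mult.assoc mult_1 mult_1_right)
qed

lemma inverse_commute:
  fixes k m x :: "'a::monoid_mult"
  assumes "k * m = 1" "m * k = 1" "k * x = x * k"
  shows "m * x = x * m"
  by (metis assms mult.assoc mult_1 mult_1_right)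

section \<open>Square roots near the unit\<close>

text \<open>The element \<open>t = 1 - \<surd>(1 - x)\<close> is the fixed point of \<open>t \<mapsto> (x + t\<^sup>2) / 2\<close>, a contraction of the
  ball of radius \<open>1 - \<surd>(1 - norm x)\<close>. Restricting it to the selfadjoint part of the bicommutant
  of \<open>x\<close> yields the remaining properties of the root.\<close>

lemma sqrt_near_one:
  fixes x :: "'a::unital_cstar_algebra"
  assumes x: "norm x < 1" "star x = x"
  obtains s where "s * s = 1 - x" "norm (1 - s) < 1" "star s = s"
    "\<And>y. x * y = y * x \<Longrightarrow> s * y = y * s"
proof -
  define \<rho> where "\<rho> = 1 - sqrt (1 - norm x)"
  have \<rho>: "0 \<le> \<rho>" "\<rho> < 1"
    using x by (simp_all add: \<rho>_def)
  have "(1 - \<rho>)\<^sup>2 = 1 - norm x"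
    using x by (simp add: \<rho>_def)
  \<comment> \<open>\<open>\<rho>\<close> is the smaller fixed point of the scalar map
    \<open>r \<mapsto> (norm x + r * r) / 2\<close>; this keeps \<open>F\<close> inside the ball of
    radius \<open>\<rho>\<close>.\<close>
  then have \<rho>_eq: "norm x + \<rho> * \<rho> = 2 * \<rho>"
    by (simp add: power2_eq_square algebra_simps)
  define S where "S = cball 0 \<rho> \<inter> {t. star t = t} \<inter> (\<Inter>y\<in>{y. x * y = y * x}. {t. t * y = y * t})"
  define F where "F = (\<lambda>t. (1/2::real) *\<^sub>R (x + t * t))"
  have "closed S"
    unfolding S_def
    by (intro closed_Int closed_INT ballI closed_cball closed_Collect_eq continuous_intros)
  then have "complete S"
    by (simp add: complete_eq_closed)
  moreover have "0 \<in> S"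
    using \<rho> by (simp add: S_def)
  moreover have "F ` S \<subseteq> S"
  proof (intro image_subsetI)
    fix t assume t: "t \<in> S"
    then have nt: "norm t \<le> \<rho>" by (simp add: S_def)
    have "norm (x + t * t) \<le> norm x + norm t * norm t"
      by (meson norm_mult_ineq norm_triangle_ineq order_trans add_left_mono)
    also have "\<dots> \<le> 2 * \<rho>"
      using mult_mono[OF nt nt] \<rho> \<rho>_eq by simp
    finally have "norm (F t) \<le> \<rho>" by (simp add: F_def)
    moreover have "star t = t" using t by (simp add: S_def)
    then have "star (F t) = F t"
      using x by (simp add: F_def star_scaleR star_add star_mult)
    moreover have "F t * y = y * F t" if y: "x * y = y * x" for y
    proof -
      have "t * y = y * t" using t y by (auto simp: S_def)
      then have "t * t * y = y * (t * t)" by (metis mult.assoc)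
      then show ?thesis using y by (simp add: F_def algebra_simps)
    qed
    ultimately show "F t \<in> S" by (simp add: S_def)
  qed
  moreover have "dist (F t) (F t') \<le> \<rho> * dist t t'" if "t \<in> S" "t' \<in> S" for t t'
  proof -
    have nt: "norm t \<le> \<rho>" "norm t' \<le> \<rho>" using that by (auto simp: S_def)
    have "F t - F t' = (1/2::real) *\<^sub>R (t * (t - t') + (t - t') * t')"
      by (simp add: F_def algebra_simps)
    then have "norm (F t - F t') = norm (t * (t - t') + (t - t') * t') / 2"
      by simp
    also have "\<dots> \<le> (norm t * norm (t - t') + norm (t - t') * norm t') / 2"
      by (intro divide_right_mono norm_triangle_le add_mono norm_mult_ineq) simp
    also have "\<dots> \<le> (\<rho> * norm (t - t') + norm (t - t') * \<rho>) / 2"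
      using nt by (intro divide_right_mono add_mono mult_mono) (auto simp: \<rho>)
    finally show ?thesis by (simp add: dist_norm mult.commute)
  qed
  ultimately obtain t where t: "t \<in> S" "F t = t"
    using Banach_fix[of S \<rho> F] \<rho> by blast
  have "x + t * t = 2 *\<^sub>R F t"
    by (simp add: F_def)
  then have eq: "x + t * t = t + t"
    by (simp add: t scaleR_2)
  show ?thesis
  proof
    show "(1 - t) * (1 - t) = 1 - x"
      using eq by (simp add: algebra_simps)
    show "norm (1 - (1 - t)) < 1"
      using t \<rho> by (auto simp: S_def)
    show "star (1 - t) = 1 - t"
      using t by (simp add: S_def star_diff)
    show "(1 - t) * y = y * (1 - t)" if "x * y = y * x" for y
      using t that by (auto simp: S_def algebra_simps)
  qed
qed

text \<open>The element \<open>y + i z\<close> is unitary and \<open>z\<close> is its imaginary part.\<close>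

lemma norm_sqrt_one_minus_square:
  fixes y z :: "'a::unital_cstar_algebra"
  assumes "star y = y" "star z = z" "y * z = z * y" "y * y + z * z = 1"
  shows "norm z \<le> 1"
proof -
  define v where "v = y + \<i> *\<^sub>C z"
  have neg: "(- \<i>) *\<^sub>C z = - (\<i> *\<^sub>C z)"
    using scaleC_scaleC[of "-1" \<i> z] scaleR_scaleC[of "-1" "\<i> *\<^sub>C z"] by simp
  have sv: "star v = y - \<i> *\<^sub>C z"
    using assms by (simp add: v_def star_add star_scaleC neg)
  have "(\<i> *\<^sub>C z) * (\<i> *\<^sub>C z) = - (z * z)"
    using scaleR_scaleC[of "-1" "z * z"] by (simp add: mult_scaleC_left mult_scaleC_right scaleC_scaleC)
  moreover have "y * (\<i> *\<^sub>C z) = (\<i> *\<^sub>C z) * y"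
    using assms by (simp add: mult_scaleC_left mult_scaleC_right)
  ultimately have "star v * v = 1"
    using assms by (simp only: sv) (simp add: v_def algebra_simps)
  then have "norm v = 1"
    using cstar_identity[of v] by (simp add: power2_eq_1_iff) (metis norm_ge_zero not_one_le_zero neg_0_le_iff_le)
  have "v - star v = \<i> *\<^sub>C z + \<i> *\<^sub>C z"
    by (simp only: sv) (simp add: v_def)
  then have "v - star v = 2 *\<^sub>R (\<i> *\<^sub>C z)"
    by (simp add: scaleR_2)
  then have "2 * norm z = norm (v - star v)"
    by (simp add: norm_scaleC)
  also have "\<dots> \<le> 2"
    using norm_triangle_ineq4[of v "star v"] \<open>norm v = 1\<close> by simp
  finally show ?thesis by simp
qed

text \<open>The root from \<open>sqrt_near_one\<close> is only known to lie within distance 1 of the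
  unit. The sharper bound on \<open>z\<close> holds because \<open>z\<close> commutes with
  \<open>y\<close> and \<open>y * y + z * z = 1\<close>.\<close>

lemma sqrt_one_minus_square:
  fixes y :: "'a::unital_cstar_algebra"
  assumes y: "star y = y" "norm y < 1"
  obtains z where "z * z = 1 - y * y" "norm z \<le> 1" "star z = z"
    "\<And>x. x * y = y * x \<Longrightarrow> z * x = x * z"
proof -
  have "norm (y * y) \<le> norm y * norm y"
    by (rule norm_mult_ineq)
  also have "\<dots> < 1"
    using y mult_strict_mono[of "norm y" 1 "norm y" 1] by simp
  finally have "norm (y * y) < 1" .
  moreover have "star (y * y) = y * y"
    using y by (simp add: star_mult)
  ultimately obtain z where z: "z * z = 1 - y * y" "star z = z"
    and comm: "\<And>x. (y * y) * x = x * (y * y) \<Longrightarrow> z * x = x * z"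
    using sqrt_near_one[of "y * y"] by metis
  have comm': "z * x = x * z" if "x * y = y * x" for x
    using that by (intro comm) (metis mult.assoc)
  have "norm z \<le> 1"
    using norm_sqrt_one_minus_square[of y z] y z comm'[of y] by simp
  with z comm' show ?thesis using that by blast
qed

text \<open>A norm substitute for \<open>y * y\<close> being nonnegative: after rescaling by
  \<open>K\<close>, the element is \<open>K\<^sup>2\<close> times the square of some
  \<open>z\<close> with \<open>norm z \<le> 1\<close>. Such bounds add up by the triangle
  inequality.\<close>

lemma norm_scaleR_one_minus_square:
  fixes y :: "'a::unital_cstar_algebra"
  assumes y: "star y = y" and K: "norm y < K"
  shows "norm (K\<^sup>2 *\<^sub>R 1 - y * y) \<le> K\<^sup>2"
proof -
  have K0: "0 < K" using K norm_ge_zero[of y] by linarith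
  have "star (y /\<^sub>R K) = y /\<^sub>R K" "norm (y /\<^sub>R K) < 1"
    using y K K0 by (simp_all add: star_scaleR field_simps)
  then obtain z where z: "z * z = 1 - (y /\<^sub>R K) * (y /\<^sub>R K)" "norm z \<le> 1"
    using sqrt_one_minus_square by metis
  have "norm (z * z) \<le> 1"
    using z(2) norm_mult_ineq[of z z] mult_mono[OF z(2) z(2)] by simp
  moreover have "K\<^sup>2 *\<^sub>R 1 - y * y = K\<^sup>2 *\<^sub>R (z * z)"
    using K0 by (simp add: z algebra_simps power2_eq_square)
  ultimately show ?thesis
    using K0 by (simp add: mult_left_le)
qed

section \<open>Positive definite elements\<close>

text \<open>A spectrum-free description of the selfadjoint elements with spectrum in \<open>(0, \<infinity>)\<close>.\<close>

definition posdef :: "'a::unital_cstar_algebra \<Rightarrow> bool" where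
  "posdef h \<longleftrightarrow> star h = h \<and> (\<exists>c. norm (c *\<^sub>R 1 - h) < c)"

text \<open>Dividing by \<open>c\<close> moves \<open>h\<close> into the open unit ball around 1,
  where \<open>sqrt_near_one\<close> applies. After scaling back, \<open>sqrt c\<close> is the
  constant that makes the root \<open>posdef\<close>.\<close>

lemma posdef_sqrt:
  fixes h :: "'a::unital_cstar_algebra"
  assumes "posdef h"
  obtains s where "s * s = h" "posdef s" "\<And>y. h * y = y * h \<Longrightarrow> s * y = y * s"
proof -
  from assms obtain c where h: "star h = h" and c: "norm (c *\<^sub>R 1 - h) < c"
    by (auto simp: posdef_def)
  have c0: "0 < c" using c norm_ge_zero[of "c *\<^sub>R 1 - h"] by linarith
  define x where "x = 1 - h /\<^sub>R c"
  have "c *\<^sub>R 1 - h = c *\<^sub>R x"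
    using c0 by (simp add: x_def algebra_simps)
  then have "norm x < 1" using c c0 by simp
  moreover have "star x = x" by (simp add: x_def star_diff star_scaleR h)
  ultimately obtain s where s: "s * s = 1 - x" "norm (1 - s) < 1" "star s = s"
    and comm: "\<And>y. x * y = y * x \<Longrightarrow> s * y = y * s"
    using sqrt_near_one by metis
  show ?thesis
  proof
    show "(sqrt c *\<^sub>R s) * (sqrt c *\<^sub>R s) = h"
      using c0 by (simp add: s x_def flip: mult.assoc)
    have "sqrt c *\<^sub>R 1 - sqrt c *\<^sub>R s = sqrt c *\<^sub>R (1 - s)"
      by (simp add: algebra_simps)
    then have "norm (sqrt c *\<^sub>R 1 - sqrt c *\<^sub>R s) < sqrt c"
      using s c0 by simp
    then show "posdef (sqrt c *\<^sub>R s)"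
      unfolding posdef_def using s by (auto simp: star_scaleR)
    show "(sqrt c *\<^sub>R s) * y = y * (sqrt c *\<^sub>R s)" if "h * y = y * h" for y
      using comm[of y] that by (simp add: x_def algebra_simps)
  qed
qed

lemma posdef_add:
  assumes "posdef h" "posdef k"
  shows "posdef (h + k)"
proof -
  obtain c d where "norm (c *\<^sub>R 1 - h) < c" "norm (d *\<^sub>R 1 - k) < d"
    using assms by (auto simp: posdef_def)
  then have "norm ((c + d) *\<^sub>R 1 - (h + k)) < c + d"
    using norm_triangle_ineq[of "c *\<^sub>R 1 - h" "d *\<^sub>R 1 - k"] by (simp add: algebra_simps)
  then show ?thesis
    using assms by (auto simp: posdef_def star_add)
qed

text \<open>If \<open>d * h = 0\<close>, then
  \<open>c *\<^sub>R d = d * (c *\<^sub>R 1 - h)\<close>, whose norm for nonzero \<open>d\<close>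
  would be strictly below \<open>c * norm d\<close>.\<close>

lemma posdef_mult_eq_zero:
  assumes "posdef h" "d * h = 0"
  shows "d = 0"
proof (rule ccontr)
  assume d: "d \<noteq> 0"
  obtain c where c: "norm (c *\<^sub>R 1 - h) < c"
    using assms by (auto simp: posdef_def)
  have c0: "0 < c" using c norm_ge_zero[of "c *\<^sub>R 1 - h"] by linarith
  have "c *\<^sub>R d = d * (c *\<^sub>R 1 - h)"
    using assms by (simp add: algebra_simps)
  then have "c * norm d = norm (d * (c *\<^sub>R 1 - h))"
    using c0 by (metis abs_of_pos norm_scaleR)
  also have "\<dots> \<le> norm d * norm (c *\<^sub>R 1 - h)"
    by (rule norm_mult_ineq)
  also have "\<dots> < norm d * c"
    using c d by simp
  finally show False by simp
qed

text \<open>Commutation gives \<open>(h - k) * (h + k) = 0\<close>, and the \<open>posdef\<close>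
  factor \<open>h + k\<close> cancels.\<close>

lemma posdef_square_cancel:
  fixes h k :: "'a::unital_cstar_algebra"
  assumes "posdef h" "posdef k" "h * k = k * h" "h * h = k * k"
  shows "h = k"
proof -
  have "(h - k) * (h + k) = 0"
    using assms by (simp add: algebra_simps)
  then have "h - k = 0"
    by (rule posdef_mult_eq_zero[OF posdef_add[OF assms(1,2)]])
  then show ?thesis by simp
qed

text \<open>The inverse keeps \<open>k * k\<close> away from 0: with
  \<open>z * z = 1 - (m /\<^sub>R M) * (m /\<^sub>R M)\<close>, it is \<open>1 / M\<^sup>2\<close>
  plus the square of \<open>k * z\<close>. This shift turns the weak bound for a square into a
  strict one.\<close>

lemma posdef_square:
  fixes k m :: "'a::unital_cstar_algebra"
  assumes k: "star k = k" and km: "k * m = 1" "m * k = 1"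
  shows "posdef (k * k)"
proof -
  define M where "M = norm m + 1"
  define K where "K = norm k + 1"
  have MK: "0 < M" "0 < K" by (simp_all add: M_def K_def add_nonneg_pos)
  have "star m = m" using star_inverse_selfadjoint[OF k km] .
  then have "star (m /\<^sub>R M) = m /\<^sub>R M" "norm (m /\<^sub>R M) < 1"
    using MK by (simp_all add: star_scaleR field_simps) (simp add: M_def)
  then obtain z where z: "z * z = 1 - (m /\<^sub>R M) * (m /\<^sub>R M)" "norm z \<le> 1" "star z = z"
    and comm: "\<And>x. x * (m /\<^sub>R M) = (m /\<^sub>R M) * x \<Longrightarrow> z * x = x * z"
    using sqrt_one_minus_square[of "m /\<^sub>R M"] by metis
  have zk: "z * k = k * z" by (intro comm) (simp add: km)
  have "star (k * z) = k * z"
    using k z zk by (simp add: star_mult)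
  moreover have "norm (k * z) < K"
    using norm_mult_ineq[of k z] z(2) mult_left_mono[OF z(2), of "norm k"] by (simp add: K_def)
  ultimately have le: "norm (K\<^sup>2 *\<^sub>R 1 - (k * z) * (k * z)) \<le> K\<^sup>2"
    by (rule norm_scaleR_one_minus_square)
  have "k * k * (m * m) = 1"
    by (metis km mult.assoc mult_1)
  have "(k * z) * (k * z) = k * k * (z * z)"
    by (metis zk mult.assoc)
  also have "\<dots> = k * k - (1 / M\<^sup>2) *\<^sub>R (k * k * (m * m))"
    by (simp add: z right_diff_distrib power2_eq_square field_simps)
  finally have eq: "(k * z) * (k * z) = k * k - (1 / M\<^sup>2) *\<^sub>R 1"
    by (simp add: \<open>k * k * (m * m) = 1\<close>)
  have "norm ((K\<^sup>2 + 1 / M\<^sup>2) *\<^sub>R 1 - k * k) \<le> K\<^sup>2"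
    using le by (simp only: eq) (simp add: algebra_simps)
  also have "\<dots> < K\<^sup>2 + 1 / M\<^sup>2"
    using MK by simp
  finally show ?thesis
    unfolding posdef_def using k by (auto simp: star_mult)
qed

section \<open>Positivity of \<open>star b * b\<close>\<close>

text \<open>With \<open>g = - v * star v\<close>, also a projection, and \<open>v = (r - i q) / 2\<close>, the sum
  \<open>r\<^sup>2 + q\<^sup>2 + 2 f + 2 g\<close> of squares of selfadjoint elements vanishes.\<close>

lemma negative_projection_zero:
  fixes f v :: "'a::unital_cstar_algebra"
  assumes f: "star f = f" "f * f = f" and v: "star v * v = - f" "v * f = v"
  shows "f = 0"
proof (rule ccontr)
  assume nz: "f \<noteq> 0"
  define g where "g = - (v * star v)"
  define r where "r = v + star v"
  define q where "q = \<i> *\<^sub>C (v - star v)"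
  have neg: "(-1) *\<^sub>C x = - x" for x :: 'a
    using scaleR_scaleC[of "-1" x] by simp
  have sa: "star g = g" "star r = r"
    by (simp_all add: g_def r_def star_minus star_mult star_add star_star add.commute)
  have "star q = (- \<i>) *\<^sub>C (star v - v)"
    by (simp add: q_def star_scaleC star_diff star_star)
  also have "\<dots> = \<i> *\<^sub>C ((-1) *\<^sub>C (star v - v))"
    by (simp add: scaleC_scaleC)
  finally have "star q = q"
    by (simp add: neg q_def)
  have "v * star v * (v * star v) = v * (star v * v) * star v"
    by (simp add: mult.assoc)
  then have gg: "g * g = g"
    using v by (simp add: g_def)
  have "q * q = (-1) *\<^sub>C ((v - star v) * (v - star v))"
    by (simp add: q_def mult_scaleC_left mult_scaleC_right scaleC_scaleC)
  then have "r * r + q * q + (f + f) + (g + g) = 0"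
    by (simp add: neg r_def g_def v algebra_simps)
  then have sum0: "r * r + q * q + g + g = - (f + f)"
    by (simp add: algebra_simps eq_neg_iff_add_eq_0)
  \<comment> \<open>One \<open>K\<close> above all three norms lets the bounds for squares be added;
    \<open>g\<close> enters twice, as \<open>g * g\<close>.\<close>
  define K where "K = norm r + norm q + norm g + 1"
  have K: "norm r < K" "norm q < K" "norm g < K"
    unfolding K_def using norm_ge_zero[of r] norm_ge_zero[of q] norm_ge_zero[of g] by linarith+
  have "norm ((K\<^sup>2 *\<^sub>R 1 - r * r) + (K\<^sup>2 *\<^sub>R 1 - q * q) + (K\<^sup>2 *\<^sub>R 1 - g * g) + (K\<^sup>2 *\<^sub>R 1 - g * g))
      \<le> K\<^sup>2 + K\<^sup>2 + K\<^sup>2 + K\<^sup>2"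
    using sa \<open>star q = q\<close> K by (intro norm_triangle_le add_mono norm_scaleR_one_minus_square order_refl
        norm_triangle_mono) auto
  moreover have "(K\<^sup>2 *\<^sub>R 1 - r * r) + (K\<^sup>2 *\<^sub>R 1 - q * q) + (K\<^sup>2 *\<^sub>R 1 - g * g) + (K\<^sup>2 *\<^sub>R 1 - g * g)
      = (4 * K\<^sup>2) *\<^sub>R 1 - (r * r + q * q + g + g)"
    by (simp add: gg algebra_simps flip: scaleR_left_distrib)
  ultimately have le: "norm ((4 * K\<^sup>2) *\<^sub>R 1 + 2 *\<^sub>R f) \<le> 4 * K\<^sup>2"
    by (simp add: sum0 scaleR_2 diff_diff_eq2 flip: add.assoc)
  \<comment> \<open>On \<open>f\<close> the element acts as the scalar
    \<open>4 * K\<^sup>2 + 2\<close>, which exceeds its norm bound.\<close>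
  have "(4 * K\<^sup>2 + 2) *\<^sub>R f = ((4 * K\<^sup>2) *\<^sub>R 1 + 2 *\<^sub>R f) * f"
    by (simp add: f algebra_simps)
  then have "(4 * K\<^sup>2 + 2) * norm f = norm (((4 * K\<^sup>2) *\<^sub>R 1 + 2 *\<^sub>R f) * f)"
    by (metis abs_of_nonneg norm_scaleR zero_le_power2 add_nonneg_nonneg mult_nonneg_nonneg zero_le_numeral)
  also have "\<dots> \<le> 4 * K\<^sup>2 * norm f"
    using norm_mult_ineq le mult_right_mono norm_ge_zero by (metis order_trans)
  finally show False
    using nz by (simp add: algebra_simps)
qed

text \<open>Here \<open>f\<close> is the spectral projection of \<open>j\<close> for the eigenvalue
  -1. Cutting \<open>w\<close> down to \<open>w * f\<close> leaves \<open>- f\<close>, so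
  \<open>negative_projection_zero\<close> excludes this eigenvalue.\<close>

lemma star_mult_involution_eq_one:
  fixes w :: "'a::unital_cstar_algebra"
  assumes "star w * w = j" "j * j = 1"
  shows "j = 1"
proof -
  have sj: "star j = j" using assms(1) by (metis star_mult star_star)
  define f where "f = (1/2::real) *\<^sub>R (1 - j)"
  have sf: "star f = f" by (simp add: f_def star_scaleR star_diff sj)
  have jf: "j * f = - f" by (simp add: f_def algebra_simps assms)
  have "f * f = (1/2::real) *\<^sub>R (f - j * f)"
    by (subst (1) f_def) (simp add: algebra_simps)
  then have ff: "f * f = f"
    by (simp add: jf flip: scaleR_2)
  have "star (w * f) * (w * f) = f * (star w * w) * f"
    by (simp add: star_mult sf mult.assoc)
  also have "\<dots> = - f"
    by (simp add: assms jf ff mult.assoc)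
  finally have "f = 0"
    using negative_projection_zero[of f "w * f"] sf ff by (simp add: mult.assoc)
  then show ?thesis by (simp add: f_def)
qed

lemma posdef_star_mult:
  fixes b m :: "'a::unital_cstar_algebra"
  assumes m: "star b * b * m = 1" "m * (star b * b) = 1"
  shows "posdef (star b * b)"
proof -
  define k where "k = star b * b"
  have sk: "star k = k" by (simp add: k_def star_mult star_star)
  have km: "k * m = 1" "m * k = 1" using m by (simp_all add: k_def)
  obtain h where h: "h * h = k * k" "posdef h"
    and hcomm: "\<And>y. k * k * y = y * (k * k) \<Longrightarrow> h * y = y * h"
    using posdef_sqrt[OF posdef_square[OF sk km]] by metis
  obtain s where s: "s * s = h" "posdef s"
    and scomm: "\<And>y. h * y = y * h \<Longrightarrow> s * y = y * s"
    using posdef_sqrt[OF h(2)] by metis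
  have hk: "h * k = k * h" by (rule hcomm) (simp add: mult.assoc)
  have sk_comm: "s * k = k * s" by (rule scomm) (rule hk)
  have ms: "m * s = s * m" using inverse_commute[OF km] sk_comm by metis
  \<comment> \<open>The inverse of \<open>s\<close>: the fourth power of \<open>s\<close> is
    \<open>k * k\<close>, and \<open>m\<close> inverts \<open>k\<close> and commutes with
    \<open>s\<close>.\<close>
  define t where "t = s * s * s * m * m"
  have "s * s * s * s * m * m = k * k * m * m"
    using h(1) by (simp add: mult.assoc flip: s(1))
  also have "\<dots> = 1" by (simp add: mult.assoc[of k k m] km)
  finally have st: "s * t = 1" "t * s = 1"
    using ms by (simp_all add: t_def mult.assoc) (metis mult.assoc)+
  have ss: "star s = s" using s(2) by (simp add: posdef_def)
  have tt: "star t = t" using star_inverse_selfadjoint[OF ss st] .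
  have tk: "t * k = k * t" using inverse_commute[OF st sk_comm] .
  have j: "star (b * t) * (b * t) = k * (t * t)"
    by (simp add: star_mult tt k_def[symmetric] mult.assoc[symmetric])
       (metis k_def mult.assoc tk)
  have th: "t * t * h = 1" by (metis s(1) st(2) mult.assoc mult_1_right)
  have ht: "h * (t * t) = 1" by (metis s(1) st(1) mult.assoc mult_1_right)
  \<comment> \<open>As \<open>t * t\<close> inverts \<open>h\<close>, the element
    \<open>k * (t * t)\<close> is the sign of \<open>k\<close>.\<close>
  have "k * (t * t) * (k * (t * t)) = k * k * (t * t) * (t * t)"
    by (metis tk mult.assoc)
  also have "\<dots> = h * (h * (t * t)) * (t * t)"
    by (simp add: h(1)[symmetric] mult.assoc)
  also have "\<dots> = 1" by (simp add: ht)
  finally have "k * (t * t) = 1"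
    using star_mult_involution_eq_one[OF j] by simp
  then have "k = h"
    by (metis th mult.assoc mult_1 mult_1_right)
  with h show ?thesis by (simp add: k_def)
qed

section \<open>Polar decomposition\<close>

lemma posdef_star_mult_invertible:
  fixes a d :: "'a::unital_cstar_algebra"
  assumes "a * d = 1" "d * a = 1"
  shows "posdef (star a * a)"
proof (rule posdef_star_mult)
  have sd: "star d * star a = 1" "star a * star d = 1"
    using assms by (metis star_mult star_one)+
  show "star a * a * (d * star d) = 1" "(d * star d) * (star a * a) = 1"
    by (metis assms sd mult.assoc mult_1)+
qed

text \<open>With \<open>n\<close> the inverse of the root \<open>h\<close>, \<open>u = a * n\<close>
  is an isometry; its right inverse \<open>h * d\<close> makes it unitary.\<close>

lemma polar_decomposition:
  fixes a :: "'a::unital_cstar_algebra"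
  assumes "invertible_element a"
  obtains u h where "unitary u" "posdef h" "a = u * h" "h * h = star a * a"
proof -
  obtain d where d: "a * d = 1" "d * a = 1"
    using assms by (auto simp: invertible_element_def)
  have sd: "star d * star a = 1" "star a * star d = 1"
    using d by (metis star_mult star_one)+
  have inv: "star a * a * (d * star d) = 1" "(d * star d) * (star a * a) = 1"
    by (metis d sd mult.assoc mult_1)+
  obtain h where h: "h * h = star a * a" "posdef h"
    using posdef_sqrt[OF posdef_star_mult_invertible[OF d]] by metis
  have sh: "star h = h" using h by (simp add: posdef_def)
  define n where "n = h * (d * star d)"
  have hn: "h * n = 1" by (simp add: n_def h(1) inv mult.assoc[symmetric]) (metis inv(1) mult.assoc)
  have "(d * star d) * h * h = 1" by (simp add: mult.assoc h(1)) (metis inv(2) mult.assoc)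
  then have nh: "n * h = 1" by (metis hn mult.assoc mult_1 mult_1_right)
  have sn: "star n = n" using star_inverse_selfadjoint[OF sh hn nh] .
  define u where "u = a * n"
  have "star u * u = n * (star a * a) * n"
    by (simp add: u_def star_mult sn mult.assoc)
  also have "\<dots> = n * h * (h * n)"
    by (simp add: h(1)[symmetric] mult.assoc)
  finally have uu: "star u * u = 1" by (simp add: hn nh)
  have "u * (h * d) = 1" unfolding u_def by (metis nh d(1) mult.assoc mult_1)
  then have "u * star u = 1" by (metis uu mult.assoc mult_1 mult_1_right)
  moreover have "a = u * h" by (simp add: u_def mult.assoc nh)
  ultimately show ?thesis
    using that uu h by (auto simp: unitary_def)
qed

theorem theorem2p8:
  fixes a :: "'a::unital_cstar_algebra"
  assumes "invertible_element a"
  shows "\<exists>!u. unitary u \<and>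
           (\<forall>p. central_projection p \<longrightarrow> positive_in (isotope (star u) p) a)"
proof -
  obtain u h where u: "unitary u" and h: "posdef h" and a: "a = u * h" and hh: "h * h = star a * a"
    using polar_decomposition[OF assms] .
  have uu: "star u * u = 1" "u * star u = 1" using u by (auto simp: unitary_def)
  obtain d where d: "a * d = 1" "d * a = 1"
    using assms by (auto simp: invertible_element_def)
  have pos: "positive_in (isotope (star u) p) a" for p
  proof -
    obtain s where s: "s * s = h" "posdef s"
      using posdef_sqrt[OF h] by metis
    have ss: "star s = s" using s by (simp add: posdef_def)
    have usu: "u * s * star u * u = u * s" by (simp add: mult.assoc uu)
    have e: "u * star (u * s) * u = u * s"
      by (simp add: star_mult ss usu mult.assoc[symmetric])
    have "u * s * star u * (u * s) = a"
      by (simp add: mult.assoc[symmetric] usu) (simp add: a s(1) mult.assoc)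
    \<comment> \<open>Both factors are \<open>u * s\<close>, so the two orders of multiplication
      agree and the weights \<open>p\<close> and \<open>1 - p\<close> add up to 1.\<close>
    moreover have "p * (u * s) * star u * (u * s) = p * (u * s * star u * (u * s))"
      "(1 - p) * (u * s) * star u * (u * s) = (1 - p) * (u * s * star u * (u * s))"
      by (simp_all add: mult.assoc)
    ultimately have "p * (u * s) * star u * (u * s) + (1 - p) * (u * s) * star u * (u * s) = a"
      by (simp add: left_diff_distrib)
    then show ?thesis
      unfolding positive_in_def isotope_def
      by (intro exI[of _ "u * s"]) (simp add: star_star e)
  qed
  have "u' = u" if u': "unitary u'"
    and pos': "\<forall>p. central_projection p \<longrightarrow> positive_in (isotope (star u') p) a" for u'
  proof -
    have uu': "star u' * u' = 1" "u' * star u' = 1" using u' by (auto simp: unitary_def)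
    have "central_projection (1::'a)" by (simp add: central_projection_def)
    with pos' obtain b where "a = u' * star b * u' * star u' * b"
      by (auto simp: positive_in_def isotope_def star_star)
    then have ab: "a = u' * (star b * b)" by (metis uu'(2) mult.assoc mult_1_right)
    define k where "k = star b * b"
    have ku: "k = star u' * a" by (simp add: ab k_def uu' flip: mult.assoc)
    have "k * (d * u') = 1" by (metis ku d(1) uu'(1) mult.assoc mult_1)
    moreover have "(d * u') * k = 1" using ab d(2) by (simp add: k_def mult.assoc)
    ultimately have k: "posdef k"
      unfolding k_def by (rule posdef_star_mult)
    then have "k * k = star k * k" by (simp add: posdef_def)
    also have "\<dots> = star a * (u' * star u') * a"
      by (simp add: ku star_mult star_star mult.assoc)
    finally have kk: "k * k = h * h" by (simp add: uu' hh)
    \<comment> \<open>Commutation of \<open>h\<close> with \<open>k\<close> is not yet available.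
      Both are compared with a third root \<open>r\<close>, which commutes with all that commutes
      with \<open>h * h = k * k\<close>.\<close>
    have "posdef (h * h)"
      unfolding hh by (rule posdef_star_mult_invertible[OF d])
    then obtain r where r: "r * r = h * h" "posdef r"
      and comm: "\<And>y. h * h * y = y * (h * h) \<Longrightarrow> r * y = y * r"
      using posdef_sqrt by metis
    have "r = h"
      by (rule posdef_square_cancel[OF r(2) h comm r(1)]) (simp add: mult.assoc)
    moreover have "r = k"
      by (rule posdef_square_cancel[OF r(2) k comm]) (simp_all add: r(1) mult.assoc flip: kk)
    ultimately have "u' * h = u * h" using ab a by (simp add: k_def)
    then have "(u' - u) * h = 0" by (simp add: algebra_simps)
    then have "u' - u = 0" by (rule posdef_mult_eq_zero[OF h])
    then show "u' = u" by simp
  qed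
  with u pos show ?thesis by blast
qed

end
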